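(* Let $A$ be a finitely generated MV-algebra. The following conditions are equivalent: (i) $A$ is residually finite; (ii) $A$ is semisimple and the maximal ideals of $A$ of finite rank form a dense subset of the maximal spectral space $\mu(A)$.
   Context: An MV-algebra is an abelian monoid $(A,0,\oplus)$ with a unary operation $\neg$ satisfying $\neg\neg x=x$, $x\oplus\neg 0=\neg 0$ and $\neg(\neg x\oplus y)\oplus y=\neg(\neg y\oplus x)\oplus x$. All MV-algebras are assumed nontrivial. An ideal of $A$ is the kernel $h^{-1}(0)$ of a homomorphism $h$ on $A$; ideals are assumed proper. $\mu(A)$ is the set of maximal ideals of $A$ with the hull-kernel topology: a basis of closed sets is given by the sets $\{\mathfrak m\in\mu(A)\mid a\in\mathfrak m\}$, $a\in A$. $A$ is semisimple if the intersection of its maximal ideals is $\{0\}$. A maximal ideal $\mathfrak m$ has finite rank if the quotient $A/\mathfrak m$ is finite. $A$ is residually finite if for any $x\neq y$ in $A$ there is a homomorphism $h$ of $A$ into a finite MV-algebra with $h(x)\neq h(y)$. *)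

theory Defs
  imports "HOL-Analysis.Analysis"
begin

record 'a mv =
  mv_carrier :: "'a set"
  mv_zero :: "'a" ("\<zero>\<index>")
  mv_oplus :: "'a \<Rightarrow> 'a \<Rightarrow> 'a" (infixl "\<oplus>\<index>" 65)
  mv_neg :: "'a \<Rightarrow> 'a" ("\<sim>\<index> _" [81] 80)

text \<open>MV-algebras are nontrivial throughout, by the last assumption.\<close>

locale mv_algebra =
  fixes A :: "'a mv" (structure)
  assumes zero_closed [simp, intro]: "\<zero> \<in> mv_carrier A"
    and oplus_closed [simp, intro]:
      "\<lbrakk>x \<in> mv_carrier A; y \<in> mv_carrier A\<rbrakk> \<Longrightarrow> x \<oplus> y \<in> mv_carrier A"
    and neg_closed [simp, intro]: "x \<in> mv_carrier A \<Longrightarrow> \<sim> x \<in> mv_carrier A"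
    and oplus_assoc:
      "\<lbrakk>x \<in> mv_carrier A; y \<in> mv_carrier A; z \<in> mv_carrier A\<rbrakk>
        \<Longrightarrow> (x \<oplus> y) \<oplus> z = x \<oplus> (y \<oplus> z)"
    and oplus_comm: "\<lbrakk>x \<in> mv_carrier A; y \<in> mv_carrier A\<rbrakk> \<Longrightarrow> x \<oplus> y = y \<oplus> x"
    and oplus_zero [simp]: "x \<in> mv_carrier A \<Longrightarrow> x \<oplus> \<zero> = x"
    and neg_neg [simp]: "x \<in> mv_carrier A \<Longrightarrow> \<sim> (\<sim> x) = x"
    and oplus_one [simp]: "x \<in> mv_carrier A \<Longrightarrow> x \<oplus> \<sim> \<zero> = \<sim> \<zero>"
    and mv_axiom:
      "\<lbrakk>x \<in> mv_carrier A; y \<in> mv_carrier A\<rbrakk>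
        \<Longrightarrow> \<sim> (\<sim> x \<oplus> y) \<oplus> y = \<sim> (\<sim> y \<oplus> x) \<oplus> x"
    and nontrivial: "mv_carrier A \<noteq> {\<zero>}"

definition mv_hom :: "'a mv \<Rightarrow> 'b mv \<Rightarrow> ('a \<Rightarrow> 'b) \<Rightarrow> bool" where
  "mv_hom A B h \<longleftrightarrow>
     (\<forall>x\<in>mv_carrier A. h x \<in> mv_carrier B) \<and>
     h \<zero>\<^bsub>A\<^esub> = \<zero>\<^bsub>B\<^esub> \<and>
     (\<forall>x\<in>mv_carrier A. \<forall>y\<in>mv_carrier A. h (x \<oplus>\<^bsub>A\<^esub> y) = h x \<oplus>\<^bsub>B\<^esub> h y) \<and>
     (\<forall>x\<in>mv_carrier A. h (\<sim>\<^bsub>A\<^esub> x) = \<sim>\<^bsub>B\<^esub> h x)"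

definition mv_kernel :: "'a mv \<Rightarrow> 'b mv \<Rightarrow> ('a \<Rightarrow> 'b) \<Rightarrow> 'a set" where
  "mv_kernel A B h = {x \<in> mv_carrier A. h x = \<zero>\<^bsub>B\<^esub>}"

inductive_set mv_generate :: "'a mv \<Rightarrow> 'a set \<Rightarrow> 'a set" for A (structure) and G where
  incl: "x \<in> G \<Longrightarrow> x \<in> mv_generate A G"
| zero: "\<zero> \<in> mv_generate A G"
| oplus: "\<lbrakk>x \<in> mv_generate A G; y \<in> mv_generate A G\<rbrakk> \<Longrightarrow> x \<oplus> y \<in> mv_generate A G"
| neg: "x \<in> mv_generate A G \<Longrightarrow> \<sim> x \<in> mv_generate A G"

definition mv_finitely_generated :: "'a mv \<Rightarrow> bool" where
  "mv_finitely_generated A \<longleftrightarrow>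
     (\<exists>G. finite G \<and> G \<subseteq> mv_carrier A \<and> mv_generate A G = mv_carrier A)"

text \<open>
  HOL cannot quantify over the type of the codomain inside a definition. It is fixed to
  \<^typ>\<open>'a set\<close>, the type in which the quotients of \<open>A\<close> live; the lemma
  \<open>mv_kernel_in_ideals\<close> below shows that kernels of homomorphisms into MV-algebras
  over any other type are included. Ideals are proper because codomains are nontrivial.
\<close>

definition mv_ideals :: "'a mv \<Rightarrow> 'a set set" where
  "mv_ideals A =
     {I. \<exists>(B :: 'a set mv) h. mv_algebra B \<and> mv_hom A B h \<and> I = mv_kernel A B h}"

definition mv_maximal_ideals :: "'a mv \<Rightarrow> 'a set set" where
  "mv_maximal_ideals A = {M \<in> mv_ideals A. \<forall>I\<in>mv_ideals A. M \<subseteq> I \<longrightarrow> I = M}"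

text \<open>
  The subbasis used here is already a basis: maximal ideals are prime, so the sets for \<open>a\<close> and
  \<open>b\<close> intersect in the set for the infimum of \<open>a\<close> and \<open>b\<close>.
\<close>

definition mv_max_spectrum :: "'a mv \<Rightarrow> 'a set topology" where
  "mv_max_spectrum A =
     topology_generated_by {mv_maximal_ideals A - {M \<in> mv_maximal_ideals A. a \<in> M} | a.
       a \<in> mv_carrier A}"

text \<open>The intersection with the carrier only matters for an empty family of ideals.\<close>

definition mv_semisimple :: "'a mv \<Rightarrow> bool" where
  "mv_semisimple A \<longleftrightarrow> mv_carrier A \<inter> \<Inter>(mv_maximal_ideals A) = {\<zero>\<^bsub>A\<^esub>}"

text \<open>
  The congruence of an ideal \<open>I\<close> relates \<open>x\<close> and \<open>y\<close> when their Chang distance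
  \<open>(x \<ominus> y) \<oplus> (y \<ominus> x)\<close> lies in \<open>I\<close>, where \<open>x \<ominus> y = \<sim> (\<sim> x \<oplus> y)\<close>.
\<close>

definition mv_cong :: "'a mv \<Rightarrow> 'a set \<Rightarrow> ('a \<times> 'a) set" where
  "mv_cong A I =
     {(x, y). x \<in> mv_carrier A \<and> y \<in> mv_carrier A \<and>
        \<sim>\<^bsub>A\<^esub> (\<sim>\<^bsub>A\<^esub> x \<oplus>\<^bsub>A\<^esub> y) \<oplus>\<^bsub>A\<^esub> \<sim>\<^bsub>A\<^esub> (\<sim>\<^bsub>A\<^esub> y \<oplus>\<^bsub>A\<^esub> x) \<in> I}"

definition mv_quotient :: "'a mv \<Rightarrow> 'a set \<Rightarrow> 'a set mv" where
  "mv_quotient A I =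
     \<lparr>mv_carrier = mv_carrier A // mv_cong A I,
      mv_zero = mv_cong A I `` {\<zero>\<^bsub>A\<^esub>},
      mv_oplus = (\<lambda>X Y. mv_cong A I `` {x \<oplus>\<^bsub>A\<^esub> y | x y. x \<in> X \<and> y \<in> Y}),
      mv_neg = (\<lambda>X. mv_cong A I `` {\<sim>\<^bsub>A\<^esub> x | x. x \<in> X})\<rparr>"

definition mv_finite_rank :: "'a mv \<Rightarrow> 'a set \<Rightarrow> bool" where
  "mv_finite_rank A M \<longleftrightarrow> finite (mv_carrier (mv_quotient A M))"

text \<open>
  Every finite MV-algebra has an isomorphic copy over \<^typ>\<open>nat\<close>; see
  \<open>mv_finite_separation\<close> below.
\<close>

definition mv_residually_finite :: "'a mv \<Rightarrow> bool" where
  "mv_residually_finite A \<longleftrightarrow>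
     (\<forall>x\<in>mv_carrier A. \<forall>y\<in>mv_carrier A. x \<noteq> y \<longrightarrow>
        (\<exists>(B :: nat mv) h. mv_algebra B \<and> finite (mv_carrier B) \<and> mv_hom A B h \<and> h x \<noteq> h y))"

context mv_algebra
begin

lemma one_neq_zero: "\<sim> \<zero> \<noteq> \<zero>"
proof
  assume "\<sim> \<zero> = \<zero>"
  then have "x = \<zero>" if "x \<in> mv_carrier A" for x
    using oplus_one[OF that] oplus_zero[OF that] by simp
  then show False
    using nontrivial zero_closed by blast
qed

lemma oplus_neg: assumes x: "x \<in> mv_carrier A" shows "x \<oplus> \<sim> x = \<sim> \<zero>"
proof -
  have "\<sim> (\<sim> x \<oplus> \<sim> \<zero>) \<oplus> \<sim> \<zero> = \<sim> (\<sim> (\<sim> \<zero>) \<oplus> x) \<oplus> x"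
    using x by (intro mv_axiom) auto
  then show ?thesis
    using x by (simp add: oplus_comm)
qed

lemma oplus_eq_zero:
  assumes x: "x \<in> mv_carrier A" and y: "y \<in> mv_carrier A" and xy: "x \<oplus> y = \<zero>"
  shows "x = \<zero>"
proof -
  have "\<sim> x = \<sim> x \<oplus> (x \<oplus> y)"
    using x xy by simp
  also have "\<dots> = (\<sim> x \<oplus> x) \<oplus> y"
    using x y by (simp add: oplus_assoc)
  also have "\<dots> = \<sim> \<zero>"
    using x y oplus_neg[OF x] by (simp add: oplus_comm)
  finally show ?thesis
    using x by (metis neg_neg zero_closed)
qed

lemma dist_eq_zero_iff:
  assumes x: "x \<in> mv_carrier A" and y: "y \<in> mv_carrier A"
  shows "\<sim> (\<sim> x \<oplus> y) \<oplus> \<sim> (\<sim> y \<oplus> x) = \<zero> \<longleftrightarrow> x = y"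
proof
  assume d: "\<sim> (\<sim> x \<oplus> y) \<oplus> \<sim> (\<sim> y \<oplus> x) = \<zero>"
  have "\<sim> (\<sim> x \<oplus> y) = \<zero>"
    by (rule oplus_eq_zero[OF _ _ d]) (use x y in auto)
  moreover have "\<sim> (\<sim> y \<oplus> x) = \<zero>"
    by (rule oplus_eq_zero[of _ "\<sim> (\<sim> x \<oplus> y)"]) (use x y d in \<open>auto simp: oplus_comm\<close>)
  ultimately show "x = y"
    using mv_axiom[OF x y] x y by (metis oplus_comm oplus_zero zero_closed)
next
  assume "x = y"
  then show "\<sim> (\<sim> x \<oplus> y) \<oplus> \<sim> (\<sim> y \<oplus> x) = \<zero>"
    using x oplus_neg[OF x] by (simp add: oplus_comm)
qed

lemma embedded_mv_algebra:
  assumes "mv_hom C A f" and inj: "inj_on f (mv_carrier C)"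
    and zero: "\<zero>\<^bsub>C\<^esub> \<in> mv_carrier C"
    and oplus: "\<And>x y. \<lbrakk>x \<in> mv_carrier C; y \<in> mv_carrier C\<rbrakk> \<Longrightarrow> x \<oplus>\<^bsub>C\<^esub> y \<in> mv_carrier C"
    and neg: "\<And>x. x \<in> mv_carrier C \<Longrightarrow> \<sim>\<^bsub>C\<^esub> x \<in> mv_carrier C"
  shows "mv_algebra C"
proof -
  have f: "f x \<in> mv_carrier A" "f (\<sim>\<^bsub>C\<^esub> x) = \<sim> f x" if "x \<in> mv_carrier C" for x
    using assms(1) that by (auto simp: mv_hom_def)
  have f2: "f (x \<oplus>\<^bsub>C\<^esub> y) = f x \<oplus> f y" if "x \<in> mv_carrier C" "y \<in> mv_carrier C" for x y
    using assms(1) that by (auto simp: mv_hom_def)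
  have f0: "f \<zero>\<^bsub>C\<^esub> = \<zero>"
    using assms(1) by (auto simp: mv_hom_def)
  note closed = zero oplus neg
  show ?thesis
  proof
    show "mv_carrier C \<noteq> {\<zero>\<^bsub>C\<^esub>}"
      using neg[OF zero] f(2)[OF zero] f0 one_neq_zero by auto
    fix x y assume xy: "x \<in> mv_carrier C" "y \<in> mv_carrier C"
    show "x \<oplus>\<^bsub>C\<^esub> y = y \<oplus>\<^bsub>C\<^esub> x"
      by (rule inj_onD[OF inj]) (use xy in \<open>auto simp: closed f f2 f0 oplus_comm\<close>)
    show "\<sim>\<^bsub>C\<^esub> (\<sim>\<^bsub>C\<^esub> x \<oplus>\<^bsub>C\<^esub> y) \<oplus>\<^bsub>C\<^esub> y = \<sim>\<^bsub>C\<^esub> (\<sim>\<^bsub>C\<^esub> y \<oplus>\<^bsub>C\<^esub> x) \<oplus>\<^bsub>C\<^esub> x"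
      by (rule inj_onD[OF inj]) (use xy in \<open>auto simp: closed f f2 f0 intro: mv_axiom\<close>)
    fix z assume z: "z \<in> mv_carrier C"
    show "(x \<oplus>\<^bsub>C\<^esub> y) \<oplus>\<^bsub>C\<^esub> z = x \<oplus>\<^bsub>C\<^esub> (y \<oplus>\<^bsub>C\<^esub> z)"
      by (rule inj_onD[OF inj]) (use xy z in \<open>auto simp: closed f f2 f0 oplus_assoc\<close>)
  next
    fix x assume x: "x \<in> mv_carrier C"
    show "x \<oplus>\<^bsub>C\<^esub> \<zero>\<^bsub>C\<^esub> = x"
      by (rule inj_onD[OF inj]) (use x in \<open>auto simp: closed f f2 f0\<close>)
    show "\<sim>\<^bsub>C\<^esub> (\<sim>\<^bsub>C\<^esub> x) = x"
      by (rule inj_onD[OF inj]) (use x in \<open>auto simp: closed f f2 f0\<close>)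
    show "x \<oplus>\<^bsub>C\<^esub> \<sim>\<^bsub>C\<^esub> \<zero>\<^bsub>C\<^esub> = \<sim>\<^bsub>C\<^esub> \<zero>\<^bsub>C\<^esub>"
      by (rule inj_onD[OF inj]) (use x in \<open>auto simp: closed f f2 f0\<close>)
  qed (use closed in auto)
qed

lemma mv_cong_kernel:
  assumes B: "mv_algebra B" and h: "mv_hom A B h"
  shows "mv_cong A (mv_kernel A B h) =
    {(x, y). x \<in> mv_carrier A \<and> y \<in> mv_carrier A \<and> h x = h y}"
proof -
  interpret B: mv_algebra B by (rule B)
  have "h (\<sim> (\<sim> x \<oplus> y) \<oplus> \<sim> (\<sim> y \<oplus> x)) = \<zero>\<^bsub>B\<^esub> \<longleftrightarrow> h x = h y"
    if "x \<in> mv_carrier A" "y \<in> mv_carrier A" for x y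
    using that h B.dist_eq_zero_iff[of "h x" "h y"] by (simp add: mv_hom_def)
  then show ?thesis
    by (auto simp: mv_cong_def mv_kernel_def)
qed

lemma mv_quotient_kernel:
  assumes B: "mv_algebra B" and h: "mv_hom A B h"
  defines "I \<equiv> mv_kernel A B h"
  shows "mv_algebra (mv_quotient A I)"
    and "mv_hom A (mv_quotient A I) (\<lambda>x. mv_cong A I `` {x})"
    and "mv_kernel A (mv_quotient A I) (\<lambda>x. mv_cong A I `` {x}) = I"
proof -
  interpret B: mv_algebra B by (rule B)
  let ?Q = "mv_quotient A I" and ?c = "\<lambda>x. mv_cong A I `` {x}"
  have c: "mv_cong A I = {(x, y). x \<in> mv_carrier A \<and> y \<in> mv_carrier A \<and> h x = h y}"
    unfolding I_def by (rule mv_cong_kernel[OF B h])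
  have hs: "\<And>x. x \<in> mv_carrier A \<Longrightarrow> h (\<sim> x) = \<sim>\<^bsub>B\<^esub> h x"
      "\<And>x y. \<lbrakk>x \<in> mv_carrier A; y \<in> mv_carrier A\<rbrakk> \<Longrightarrow> h (x \<oplus> y) = h x \<oplus>\<^bsub>B\<^esub> h y"
      "\<And>x. x \<in> mv_carrier A \<Longrightarrow> h x \<in> mv_carrier B" "h \<zero> = \<zero>\<^bsub>B\<^esub>"
    using h by (auto simp: mv_hom_def)
  have carr: "mv_carrier ?Q = ?c ` mv_carrier A"
    by (auto simp: mv_quotient_def quotient_def)
  have z: "\<zero>\<^bsub>?Q\<^esub> = ?c \<zero>"
    by (simp add: mv_quotient_def)
  have o: "?c x \<oplus>\<^bsub>?Q\<^esub> ?c y = ?c (x \<oplus> y)" if "x \<in> mv_carrier A" "y \<in> mv_carrier A" for x y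
  proof -
    have "{u \<oplus> v | u v. u \<in> ?c x \<and> v \<in> ?c y} \<subseteq> ?c (x \<oplus> y)"
      using that unfolding c by (auto simp: hs)
    moreover have "x \<oplus> y \<in> {u \<oplus> v | u v. u \<in> ?c x \<and> v \<in> ?c y}"
      using that unfolding c by blast
    ultimately have "mv_cong A I `` {u \<oplus> v | u v. u \<in> ?c x \<and> v \<in> ?c y} = ?c (x \<oplus> y)"
      unfolding c by fastforce
    then show ?thesis
      by (simp add: mv_quotient_def)
  qed
  have n: "\<sim>\<^bsub>?Q\<^esub> (?c x) = ?c (\<sim> x)" if "x \<in> mv_carrier A" for x
  proof -
    have "{\<sim> u | u. u \<in> ?c x} \<subseteq> ?c (\<sim> x)"
      using that unfolding c by (auto simp: hs)
    moreover have "\<sim> x \<in> {\<sim> u | u. u \<in> ?c x}"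
      using that unfolding c by blast
    ultimately have "mv_cong A I `` {\<sim> u | u. u \<in> ?c x} = ?c (\<sim> x)"
      unfolding c by fastforce
    then show ?thesis
      by (simp add: mv_quotient_def)
  qed
  have ceq: "?c x = ?c y \<longleftrightarrow> h x = h y" if "x \<in> mv_carrier A" "y \<in> mv_carrier A" for x y
    using that unfolding c by auto
  define f where "f X = h (SOME x. x \<in> X)" for X
  have f: "f (?c x) = h x" if "x \<in> mv_carrier A" for x
  proof -
    have "(SOME y. y \<in> ?c x) \<in> ?c x"
      by (rule someI[of _ x]) (use that c in auto)
    then show ?thesis
      unfolding f_def c by auto
  qed
  show "mv_algebra ?Q"
  proof (rule B.embedded_mv_algebra[of _ f])
    show "mv_hom ?Q B f"
      by (auto simp: mv_hom_def carr z o n f hs)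
    show "inj_on f (mv_carrier ?Q)"
      by (auto simp: inj_on_def carr f ceq)
  qed (auto simp: carr z o n)
  show "mv_hom A ?Q ?c"
    by (auto simp: mv_hom_def carr z o n)
  have "mv_kernel A ?Q ?c = {x \<in> mv_carrier A. h x = \<zero>\<^bsub>B\<^esub>}"
    unfolding mv_kernel_def z using ceq[OF _ zero_closed] hs(4) by auto
  also have "\<dots> = I"
    by (simp add: I_def mv_kernel_def)
  finally show "mv_kernel A ?Q ?c = I" .
qed

lemma mv_kernel_in_ideals:
  fixes B :: "'b mv"
  assumes "mv_algebra B" and "mv_hom A B h"
  shows "mv_kernel A B h \<in> mv_ideals A"
  unfolding mv_ideals_def using mv_quotient_kernel[OF assms] by blast

lemma mv_quotient_ideal:
  assumes "I \<in> mv_ideals A"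
  shows "mv_algebra (mv_quotient A I)"
    and "mv_hom A (mv_quotient A I) (\<lambda>x. mv_cong A I `` {x})"
    and "mv_kernel A (mv_quotient A I) (\<lambda>x. mv_cong A I `` {x}) = I"
proof -
  obtain B :: "'a set mv" and h where B: "mv_algebra B" "mv_hom A B h" "I = mv_kernel A B h"
    using assms unfolding mv_ideals_def by blast
  show "mv_algebra (mv_quotient A I)"
    and "mv_hom A (mv_quotient A I) (\<lambda>x. mv_cong A I `` {x})"
    and "mv_kernel A (mv_quotient A I) (\<lambda>x. mv_cong A I `` {x}) = I"
    unfolding B(3) by (fact mv_quotient_kernel[OF B(1,2)])+
qed

lemma one_notin_ideal:
  assumes "I \<in> mv_ideals A" shows "\<sim> \<zero> \<notin> I"
proof -
  obtain B :: "'a set mv" and h where B: "mv_algebra B" "mv_hom A B h" "I = mv_kernel A B h"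
    using assms unfolding mv_ideals_def by blast
  then show ?thesis
    using mv_algebra.one_neq_zero[OF B(1)] by (simp add: mv_kernel_def mv_hom_def)
qed

lemma topspace_mv_max_spectrum: "topspace (mv_max_spectrum A) = mv_maximal_ideals A"
proof -
  have "M \<in> mv_maximal_ideals A - {M \<in> mv_maximal_ideals A. \<sim> \<zero> \<in> M}"
    if "M \<in> mv_maximal_ideals A" for M
    using that one_notin_ideal by (auto simp: mv_maximal_ideals_def)
  then show ?thesis
    unfolding mv_max_spectrum_def topology_generated_by_topspace by blast
qed

end

lemma mv_finite_separation:
  fixes A :: "'a mv" and B :: "'b mv"
  assumes B: "mv_algebra B" and fin: "finite (mv_carrier B)" and h: "mv_hom A B h"
  shows "\<exists>(B' :: nat mv) h'. mv_algebra B' \<and> finite (mv_carrier B') \<and> mv_hom A B' h' \<and>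
    (\<forall>x\<in>mv_carrier A. \<forall>y\<in>mv_carrier A. h' x = h' y \<longleftrightarrow> h x = h y)"
proof -
  interpret B: mv_algebra B by (rule B)
  obtain g :: "'b \<Rightarrow> nat" where g: "inj_on g (mv_carrier B)"
    using finite_imp_inj_to_nat_seg[OF fin] by blast
  define k where "k = inv_into (mv_carrier B) g"
  have k [simp]: "k (g x) = x" if "x \<in> mv_carrier B" for x
    unfolding k_def by (rule inv_into_f_f[OF g that])
  define C where "C = \<lparr>mv_carrier = g ` mv_carrier B, mv_zero = g \<zero>\<^bsub>B\<^esub>,
    mv_oplus = (\<lambda>x y. g (k x \<oplus>\<^bsub>B\<^esub> k y)), mv_neg = (\<lambda>x. g (\<sim>\<^bsub>B\<^esub> k x))\<rparr>"
  have C: "mv_algebra C"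
  proof (rule B.embedded_mv_algebra[of _ k])
    show "mv_hom C B k" by (auto simp: mv_hom_def C_def)
    show "inj_on k (mv_carrier C)" by (auto simp: inj_on_def C_def)
  qed (auto simp: C_def)
  show ?thesis
  proof (intro exI[of _ C] exI[of _ "g \<circ> h"] conjI C)
    show "finite (mv_carrier C)" using fin by (simp add: C_def)
    show "mv_hom A C (g \<circ> h)" using h by (auto simp: mv_hom_def C_def)
    show "\<forall>x\<in>mv_carrier A. \<forall>y\<in>mv_carrier A. (g \<circ> h) x = (g \<circ> h) y \<longleftrightarrow> h x = h y"
      using h inj_onD[OF g] by (auto simp: mv_hom_def)
  qed
qed

end

theory Submission
  imports Defs
begin

text \<open>
  If \<open>h\<close> maps \<open>A\<close> to a finite MV-algebra and \<open>h a \<noteq> 0\<close>, some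
  multiple \<open>e = n (h a)\<close> is a nonzero idempotent. The elements \<open>x\<close> with \<open>h x \<oplus> \<not> e = \<not> e\<close> form a
  proper ideal containing the kernel of \<open>h\<close> and \<open>\<not> (n a)\<close>. A maximal ideal above it has finite
  rank and omits \<open>a\<close>; this gives both semisimplicity and density. Conversely, distinct \<open>x\<close> and \<open>y\<close>
  have nonzero distance \<open>d\<close>, semisimplicity makes the open set of maximal ideals omitting \<open>d\<close>
  nonempty, and the quotient by a finite-rank member of it separates \<open>x\<close> from \<open>y\<close>.
\<close>

section \<open>Multiples, the natural order, and ideals described by their elements\<close>

primrec mv_mult :: "'a mv \<Rightarrow> nat \<Rightarrow> 'a \<Rightarrow> 'a" where
  "mv_mult A 0 x = \<zero>\<^bsub>A\<^esub>"
| "mv_mult A (Suc n) x = x \<oplus>\<^bsub>A\<^esub> mv_mult A n x"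

definition mv_le :: "'a mv \<Rightarrow> 'a \<Rightarrow> 'a \<Rightarrow> bool" where
  "mv_le A x y \<longleftrightarrow> \<sim>\<^bsub>A\<^esub> x \<oplus>\<^bsub>A\<^esub> y = \<sim>\<^bsub>A\<^esub> \<zero>\<^bsub>A\<^esub>"

text \<open>\<open>mv_ideals\<close> is defined through kernels, yet the ideals built later are
  given by their elements, with no homomorphism at hand. This intrinsic description serves to
  construct them; \<open>mv_ideals_iff\<close> shows that the two notions agree, properness matching
  the nontriviality of codomains.\<close>

locale mv_ideal = mv_algebra +
  fixes I
  assumes ideal_subset: "I \<subseteq> mv_carrier A"
    and ideal_zero: "\<zero> \<in> I"
    and ideal_oplus: "\<lbrakk>x \<in> I; y \<in> I\<rbrakk> \<Longrightarrow> x \<oplus> y \<in> I"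
    and ideal_down: "\<lbrakk>x \<in> mv_carrier A; y \<in> I; mv_le A x y\<rbrakk> \<Longrightarrow> x \<in> I"
    and ideal_proper: "\<sim> \<zero> \<notin> I"

context mv_algebra
begin

lemma oplus_left_comm:
  assumes "x \<in> mv_carrier A" "y \<in> mv_carrier A" "z \<in> mv_carrier A"
  shows "x \<oplus> (y \<oplus> z) = y \<oplus> (x \<oplus> z)"
  using assms by (metis oplus_assoc oplus_comm)

lemmas oplus_ac = oplus_assoc oplus_comm oplus_left_comm

lemma zero_oplus [simp]: "x \<in> mv_carrier A \<Longrightarrow> \<zero> \<oplus> x = x"
  by (simp add: oplus_comm)

lemma one_oplus [simp]: "x \<in> mv_carrier A \<Longrightarrow> \<sim> \<zero> \<oplus> x = \<sim> \<zero>"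
  by (simp add: oplus_comm)

lemma neg_oplus: "x \<in> mv_carrier A \<Longrightarrow> \<sim> x \<oplus> x = \<sim> \<zero>"
  using oplus_neg by (simp add: oplus_comm)

lemma oplus_neg_oplus:
  assumes "x \<in> mv_carrier A" "y \<in> mv_carrier A"
  shows "x \<oplus> (\<sim> x \<oplus> y) = \<sim> \<zero>"
  using assms oplus_neg[of x] by (simp flip: oplus_assoc)

text \<open>\<open>mv_axiom\<close> expresses that the join of \<open>x\<close> and \<open>y\<close>
  does not depend on their order. If \<open>x\<close> is below \<open>y\<close>, one side reduces to
  \<open>y\<close> and the other is \<open>x\<close> plus the truncated difference of
  \<open>y\<close> and \<open>x\<close>, which serves as \<open>t\<close>.\<close>

lemma le_iff_ex:
  assumes x: "x \<in> mv_carrier A" and y: "y \<in> mv_carrier A"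
  shows "mv_le A x y \<longleftrightarrow> (\<exists>t\<in>mv_carrier A. y = x \<oplus> t)"
proof
  assume "mv_le A x y"
  then have "y = \<sim> (\<sim> x \<oplus> y) \<oplus> y"
    using y by (simp add: mv_le_def)
  also have "\<dots> = x \<oplus> \<sim> (\<sim> y \<oplus> x)"
    using x y mv_axiom[OF x y] by (simp add: oplus_comm)
  finally show "\<exists>t\<in>mv_carrier A. y = x \<oplus> t"
    using x y by blast
next
  assume "\<exists>t\<in>mv_carrier A. y = x \<oplus> t"
  then obtain t where t: "t \<in> mv_carrier A" "y = x \<oplus> t" by blast
  then have "\<sim> x \<oplus> y = (\<sim> x \<oplus> x) \<oplus> t"
    using x by (simp add: oplus_assoc)
  then show "mv_le A x y"
    using x t by (simp add: mv_le_def neg_oplus)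
qed

lemma le_refl: "x \<in> mv_carrier A \<Longrightarrow> mv_le A x x"
  by (simp add: mv_le_def neg_oplus)

lemma le_trans:
  assumes "x \<in> mv_carrier A" "y \<in> mv_carrier A" "z \<in> mv_carrier A"
    and "mv_le A x y" "mv_le A y z"
  shows "mv_le A x z"
  using assms by (metis le_iff_ex oplus_assoc oplus_closed)

lemma le_antisym:
  assumes "x \<in> mv_carrier A" "y \<in> mv_carrier A" "mv_le A x y" "mv_le A y x"
  shows "x = y"
  using assms dist_eq_zero_iff[of x y] by (simp add: mv_le_def)

lemma le_oplus1:
  assumes "x \<in> mv_carrier A" "y \<in> mv_carrier A" shows "mv_le A x (x \<oplus> y)"
  using assms by (auto simp: le_iff_ex)

lemma le_oplus2:
  assumes "x \<in> mv_carrier A" "y \<in> mv_carrier A" shows "mv_le A x (y \<oplus> x)"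
  using le_oplus1[OF assms] assms by (simp add: oplus_comm)

lemma oplus_mono:
  assumes c: "x \<in> mv_carrier A" "y \<in> mv_carrier A" "u \<in> mv_carrier A" "v \<in> mv_carrier A"
    and "mv_le A x y" "mv_le A u v"
  shows "mv_le A (x \<oplus> u) (y \<oplus> v)"
proof -
  obtain s t where st: "s \<in> mv_carrier A" "t \<in> mv_carrier A" "y = x \<oplus> s" "v = u \<oplus> t"
    using assms by (auto simp: le_iff_ex)
  then have "y \<oplus> v = (x \<oplus> u) \<oplus> (s \<oplus> t)"
    using c by (simp add: oplus_ac)
  then show ?thesis
    using c st by (auto intro: le_oplus1)
qed

lemma le_one_imp_eq: "x \<in> mv_carrier A \<Longrightarrow> mv_le A (\<sim> \<zero>) x \<Longrightarrow> x = \<sim> \<zero>"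
  by (simp add: mv_le_def)

lemma mult_closed [simp]: "x \<in> mv_carrier A \<Longrightarrow> mv_mult A n x \<in> mv_carrier A"
  by (induction n) auto

lemma mult_add:
  assumes "x \<in> mv_carrier A"
  shows "mv_mult A (m + n) x = mv_mult A m x \<oplus> mv_mult A n x"
  using assms by (induction m) (auto simp: oplus_assoc)

lemma mult_eq_zeroD:
  assumes "x \<in> mv_carrier A" "mv_mult A n x = \<zero>" "n > 0"
  shows "x = \<zero>"
  using assms oplus_eq_zero[of x "mv_mult A (n - 1) x"] by (cases n) auto

lemma hom_mult:
  assumes "mv_hom A B h" "x \<in> mv_carrier A"
  shows "h (mv_mult A n x) = mv_mult B n (h x)"
  using assms by (induction n) (auto simp: mv_hom_def)

text \<open>Both sides of \<open>mv_axiom\<close> for \<open>e\<close> and \<open>\<sim> e\<close>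
  are the join of these two elements. Idempotence turns one side into
  \<open>\<sim> e \<oplus> e\<close>, the top element; that the other side is the top element is
  literally the inequality \<open>mv_le A (\<sim> e \<oplus> \<sim> e) (\<sim> e)\<close>.\<close>

lemma neg_idempotent:
  assumes e: "e \<in> mv_carrier A" "e \<oplus> e = e"
  shows "\<sim> e \<oplus> \<sim> e = \<sim> e"
proof -
  have "\<sim> (\<sim> e \<oplus> \<sim> e) \<oplus> \<sim> e = \<sim> (\<sim> (\<sim> e) \<oplus> e) \<oplus> e"
    using e by (intro mv_axiom) auto
  also have "\<dots> = \<sim> \<zero>"
    using e by (simp add: neg_oplus)
  finally have "mv_le A (\<sim> e \<oplus> \<sim> e) (\<sim> e)"
    by (simp add: mv_le_def)
  then show ?thesis
    using e le_oplus1[of "\<sim> e" "\<sim> e"] by (intro le_antisym) auto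
qed

text \<open>
  If \<open>i x = (i + d) x\<close>, the multiples of \<open>x\<close> are \<open>d\<close>-periodic from \<open>i\<close> on, so any multiple of
  \<open>d\<close> beyond \<open>i\<close> will do.
\<close>

lemma finite_ex_idempotent_mult:
  assumes fin: "finite (mv_carrier A)" and x: "x \<in> mv_carrier A"
  obtains n where "n > 0" "mv_mult A n x \<oplus> mv_mult A n x = mv_mult A n x"
proof -
  have "finite (range (\<lambda>n. mv_mult A n x))"
    by (rule finite_subset[OF _ fin]) (use x in auto)
  then have "\<not> inj (\<lambda>n. mv_mult A n x)"
    using finite_imageD infinite_UNIV_nat by blast
  then obtain i d where d: "d > 0" "mv_mult A (i + d) x = mv_mult A i x"
    unfolding inj_def by (metis less_imp_add_positive linorder_neqE_nat)
  have period: "mv_mult A (i + j + k * d) x = mv_mult A (i + j) x" for j k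
  proof (induction k)
    case (Suc k)
    have "mv_mult A (i + j + Suc k * d) x = mv_mult A (i + d) x \<oplus> mv_mult A (j + k * d) x"
      using mult_add[OF x, of "i + d" "j + k * d"] by (simp add: ac_simps)
    also have "\<dots> = mv_mult A (i + j + k * d) x"
      using mult_add[OF x, of i "j + k * d"] d by (simp add: ac_simps)
    finally show ?case using Suc by simp
  qed simp
  \<comment> \<open>The factor \<open>Suc i\<close> instead of \<open>i\<close> keeps
    \<open>n\<close> positive when \<open>i = 0\<close>. Positivity is what later makes the
    idempotent multiple of a nonzero element nonzero.\<close>
  define n where "n = Suc i * d"
  have "n \<ge> i"
  proof -
    have "i \<le> Suc i * 1" by simp
    also have "\<dots> \<le> Suc i * d" using d by (intro mult_le_mono2) auto
    finally show ?thesis by (simp add: n_def)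
  qed
  then have "mv_mult A (n + n) x = mv_mult A n x"
    using period[of "n - i" "Suc i"] by (simp add: n_def)
  moreover have "n > 0"
    using d by (simp add: n_def)
  ultimately show ?thesis
    using that mult_add[OF x] by metis
qed

text \<open>All axioms but the last are closure conditions or equations, and these pass to the image
  of a map preserving the operations; \<open>mv_hom\<close> itself demands nothing of the codomain.
  Nontriviality can be lost, hence the hypothesis \<open>nt\<close>.\<close>

lemma hom_image_mv_algebra:
  assumes h: "mv_hom A C h" and carr: "mv_carrier C = h ` mv_carrier A"
    and nt: "h (\<sim> \<zero>) \<noteq> h \<zero>"
  shows "mv_algebra C"
proof -
  have hs: "\<And>x. x \<in> mv_carrier A \<Longrightarrow> \<sim>\<^bsub>C\<^esub> h x = h (\<sim> x)"
      "\<And>x y. \<lbrakk>x \<in> mv_carrier A; y \<in> mv_carrier A\<rbrakk> \<Longrightarrow> h x \<oplus>\<^bsub>C\<^esub> h y = h (x \<oplus> y)"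
      "\<zero>\<^bsub>C\<^esub> = h \<zero>"
    using h by (auto simp: mv_hom_def)
  show ?thesis
  proof
    show "mv_carrier C \<noteq> {\<zero>\<^bsub>C\<^esub>}"
      using nt unfolding carr hs by blast
  qed (auto simp: carr hs oplus_assoc mv_axiom, auto simp: oplus_comm)
qed

lemma mv_idealsD:
  assumes "I \<in> mv_ideals A"
  shows "mv_ideal A I"
proof -
  obtain B :: "'a set mv" and h where B: "mv_algebra B" and h: "mv_hom A B h"
      and I: "I = mv_kernel A B h"
    using assms unfolding mv_ideals_def by blast
  interpret B: mv_algebra B by (rule B)
  show ?thesis
  proof
    show "\<sim> \<zero> \<notin> I" by (rule one_notin_ideal[OF assms])
    fix x y assume "x \<in> mv_carrier A" "y \<in> I" "mv_le A x y"
    then show "x \<in> I"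
      using h B.oplus_eq_zero unfolding I mv_kernel_def mv_hom_def
      by simp (metis le_iff_ex)
  qed (use h in \<open>auto simp: I mv_kernel_def mv_hom_def\<close>)
qed

end

section \<open>The congruence of an ideal, and ideals as kernels\<close>

context mv_ideal
begin

lemma mem_carrier: "x \<in> I \<Longrightarrow> x \<in> mv_carrier A"
  using ideal_subset by blast

lemma mult_mem: "x \<in> I \<Longrightarrow> mv_mult A n x \<in> I"
  by (induction n) (auto intro: ideal_zero ideal_oplus)

lemma not_neg_mem: "x \<in> I \<Longrightarrow> \<sim> x \<notin> I"
  using ideal_oplus[of x "\<sim> x"] ideal_proper oplus_neg mem_carrier by auto

text \<open>Residuation: a truncated difference of \<open>u\<close> and \<open>v\<close> is below
  \<open>i\<close> exactly when \<open>u\<close> is below \<open>v \<oplus> i\<close>. This trades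
  the Chang distance for inequalities that can be added, so transitivity and compatibility with
  \<open>\<oplus>\<close> follow with the sum of the two bounds as new bound.\<close>

lemma cong_iff:
  "(x, y) \<in> mv_cong A I \<longleftrightarrow> x \<in> mv_carrier A \<and> y \<in> mv_carrier A \<and>
    (\<exists>i\<in>I. mv_le A x (y \<oplus> i) \<and> mv_le A y (x \<oplus> i))"
proof -
  have residuation: "mv_le A (\<sim> (\<sim> u \<oplus> v)) i \<longleftrightarrow> mv_le A u (v \<oplus> i)"
    if "u \<in> mv_carrier A" "v \<in> mv_carrier A" "i \<in> mv_carrier A" for u v i
    using that by (simp add: mv_le_def oplus_assoc)
  show ?thesis
  proof (intro iffI)
    assume xy: "(x, y) \<in> mv_cong A I"
    let ?i = "\<sim> (\<sim> x \<oplus> y) \<oplus> \<sim> (\<sim> y \<oplus> x)"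
    have "x \<in> mv_carrier A" "y \<in> mv_carrier A" "?i \<in> I"
      using xy by (auto simp: mv_cong_def)
    then show "x \<in> mv_carrier A \<and> y \<in> mv_carrier A \<and>
        (\<exists>i\<in>I. mv_le A x (y \<oplus> i) \<and> mv_le A y (x \<oplus> i))"
      using le_oplus1[of "\<sim> (\<sim> x \<oplus> y)" "\<sim> (\<sim> y \<oplus> x)"]
        le_oplus2[of "\<sim> (\<sim> y \<oplus> x)" "\<sim> (\<sim> x \<oplus> y)"]
      by (intro conjI bexI[of _ ?i]) (simp_all add: residuation)
  next
    assume xy: "x \<in> mv_carrier A \<and> y \<in> mv_carrier A \<and>
        (\<exists>i\<in>I. mv_le A x (y \<oplus> i) \<and> mv_le A y (x \<oplus> i))"
    then obtain i where i: "i \<in> I" "mv_le A x (y \<oplus> i)" "mv_le A y (x \<oplus> i)" by blast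
    then have "\<sim> (\<sim> x \<oplus> y) \<in> I" "\<sim> (\<sim> y \<oplus> x) \<in> I"
      using xy mem_carrier[OF i(1)] by (auto intro!: ideal_down[OF _ i(1)] simp: residuation)
    then show "(x, y) \<in> mv_cong A I"
      using xy ideal_oplus by (auto simp: mv_cong_def)
  qed
qed

lemma cong_equiv: "equiv (mv_carrier A) (mv_cong A I)"
proof (rule equivI)
  show "mv_cong A I \<subseteq> mv_carrier A \<times> mv_carrier A"
    by (auto simp: mv_cong_def)
  show "refl_on (mv_carrier A) (mv_cong A I)"
    unfolding refl_on_def cong_iff using ideal_zero le_oplus1 by (metis zero_closed)
  show "sym (mv_cong A I)"
    unfolding sym_def cong_iff by blast
  show "trans (mv_cong A I)"
  proof (rule transI)
    fix x y z assume "(x, y) \<in> mv_cong A I" "(y, z) \<in> mv_cong A I"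
    then obtain i j where c: "x \<in> mv_carrier A" "y \<in> mv_carrier A" "z \<in> mv_carrier A"
      and ij: "i \<in> I" "j \<in> I"
        "mv_le A x (y \<oplus> i)" "mv_le A y (x \<oplus> i)" "mv_le A y (z \<oplus> j)" "mv_le A z (y \<oplus> j)"
      unfolding cong_iff by blast
    note ic = mem_carrier[OF ij(1)] mem_carrier[OF ij(2)]
    have "mv_le A (y \<oplus> i) (z \<oplus> j \<oplus> i)" "mv_le A (y \<oplus> j) (x \<oplus> i \<oplus> j)"
      using c ij ic by (auto intro!: oplus_mono le_refl)
    then have "mv_le A x (z \<oplus> j \<oplus> i)" "mv_le A z (x \<oplus> i \<oplus> j)"
      using c ij ic by (meson le_trans oplus_closed)+
    then show "(x, z) \<in> mv_cong A I"
      unfolding cong_iff using c ic ideal_oplus[OF ij(1,2)]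
      by (intro conjI bexI[of _ "i \<oplus> j"]) (simp_all add: oplus_ac)
  qed
qed

text \<open>Negating both arguments merely swaps the two summands of the Chang distance.\<close>

lemma cong_neg: "(x, y) \<in> mv_cong A I \<Longrightarrow> (\<sim> x, \<sim> y) \<in> mv_cong A I"
  unfolding mv_cong_def by (auto simp: oplus_comm)

lemma cong_oplus:
  assumes "(x, y) \<in> mv_cong A I" "(u, v) \<in> mv_cong A I"
  shows "(x \<oplus> u, y \<oplus> v) \<in> mv_cong A I"
proof -
  obtain i j where c: "x \<in> mv_carrier A" "y \<in> mv_carrier A" "u \<in> mv_carrier A" "v \<in> mv_carrier A"
    and ij: "i \<in> I" "j \<in> I"
      "mv_le A x (y \<oplus> i)" "mv_le A y (x \<oplus> i)" "mv_le A u (v \<oplus> j)" "mv_le A v (u \<oplus> j)"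
    using assms unfolding cong_iff by blast
  note ic = mem_carrier[OF ij(1)] mem_carrier[OF ij(2)]
  have "mv_le A (x \<oplus> u) ((y \<oplus> i) \<oplus> (v \<oplus> j))" "mv_le A (y \<oplus> v) ((x \<oplus> i) \<oplus> (u \<oplus> j))"
    using c ij ic by (auto intro!: oplus_mono)
  then show ?thesis
    unfolding cong_iff using c ic ideal_oplus[OF ij(1,2)]
    by (intro conjI bexI[of _ "i \<oplus> j"]) (simp_all add: oplus_ac)
qed

lemma cong_zero_iff: "(x, \<zero>) \<in> mv_cong A I \<longleftrightarrow> x \<in> I"
  unfolding mv_cong_def using mem_carrier by (auto simp: oplus_comm)

text \<open>
  The quotient is realised on representatives, so that it is a homomorphic image of \<open>A\<close> over the
  same type.
\<close>

lemma mem_mv_ideals: "I \<in> mv_ideals A"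
proof -
  define r where "r x = (SOME y. (x, y) \<in> mv_cong A I)" for x
  note refl = equiv_class_self[OF cong_equiv, unfolded Image_singleton_iff]
  have r: "(x, r x) \<in> mv_cong A I" if "x \<in> mv_carrier A" for x
    unfolding r_def by (rule someI[of _ x]) (use refl[OF that] in auto)
  have sym: "(y, x) \<in> mv_cong A I" if "(x, y) \<in> mv_cong A I" for x y
    using that cong_equiv by (meson equivE symE)
  have tr: "(x, z) \<in> mv_cong A I" if "(x, y) \<in> mv_cong A I" "(y, z) \<in> mv_cong A I" for x y z
    using that cong_equiv by (meson equivE transE)
  \<comment> \<open>Congruent elements satisfy the same choice predicate, so the choice operator
    returns the same representative for both.\<close>
  have r_eq: "r x = r y" if "(x, y) \<in> mv_cong A I" for x y
    unfolding r_def by (rule arg_cong[where f = Eps]) (use that sym tr in blast)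
  have r_eq_iff: "r x = r y \<longleftrightarrow> (x, y) \<in> mv_cong A I"
    if "x \<in> mv_carrier A" "y \<in> mv_carrier A" for x y
    using r_eq that r[of x] r[of y] sym tr by metis
  define C where "C = \<lparr>mv_carrier = r ` mv_carrier A, mv_zero = r \<zero>,
    mv_oplus = (\<lambda>x y. r (x \<oplus> y)), mv_neg = (\<lambda>x. r (\<sim> x))\<rparr>"
  have hom: "mv_hom A C r"
    by (auto simp: mv_hom_def C_def intro!: r_eq cong_oplus cong_neg r)
  have "mv_algebra C"
  proof (rule hom_image_mv_algebra[OF hom])
    show "r (\<sim> \<zero>) \<noteq> r \<zero>"
      by (simp add: r_eq_iff cong_zero_iff ideal_proper)
  qed (simp add: C_def)
  then have "mv_kernel A C r \<in> mv_ideals A"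
    using hom by (rule mv_kernel_in_ideals)
  also have "mv_kernel A C r = I"
    using mem_carrier by (auto simp: mv_kernel_def C_def r_eq_iff cong_zero_iff)
  finally show ?thesis .
qed

end

section \<open>Maximal ideals and the topology of the maximal spectrum\<close>

context mv_algebra
begin

lemma mv_ideals_iff: "I \<in> mv_ideals A \<longleftrightarrow> mv_ideal A I"
  using mv_idealsD mv_ideal.mem_mv_ideals by blast

text \<open>The set \<open>J\<close> is what \<open>M\<close> and \<open>a\<close> generate. It
  strictly contains \<open>M\<close>, so by maximality it cannot be proper, and the top element is
  some \<open>m \<oplus> mv_mult A n a\<close> with \<open>m\<close> in \<open>M\<close>. This puts
  the negation of the multiple below \<open>m\<close>.\<close>

lemma maximal_ideal_neg_mult:
  assumes M: "M \<in> mv_maximal_ideals A" and a: "a \<in> mv_carrier A" "a \<notin> M"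
  obtains n where "\<sim> (mv_mult A n a) \<in> M"
proof -
  interpret M: mv_ideal A M
    using M mv_idealsD by (auto simp: mv_maximal_ideals_def)
  define J where "J = {x \<in> mv_carrier A. \<exists>m\<in>M. \<exists>n. mv_le A x (m \<oplus> mv_mult A n a)}"
  have M_J: "M \<subseteq> J"
  proof
    fix m assume m: "m \<in> M"
    then have "mv_le A m (m \<oplus> mv_mult A 0 a)"
      using M.mem_carrier le_refl by simp
    then show "m \<in> J"
      using m M.mem_carrier unfolding J_def by blast
  qed
  have "mv_le A a (\<zero> \<oplus> mv_mult A 1 a)"
    using a by (simp add: le_refl)
  then have a_J: "a \<in> J"
    using a M.ideal_zero unfolding J_def by blast
  have one_J: "\<sim> \<zero> \<in> J"
  proof (rule ccontr)
    assume one: "\<sim> \<zero> \<notin> J"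
    have "mv_ideal A J"
    proof
      show "J \<subseteq> mv_carrier A" by (auto simp: J_def)
      show "\<zero> \<in> J" using M_J M.ideal_zero by blast
      show "\<sim> \<zero> \<notin> J" by (fact one)
    next
      fix x y assume "x \<in> J" "y \<in> J"
      then obtain m n k l where xy: "x \<in> mv_carrier A" "y \<in> mv_carrier A" "m \<in> M" "n \<in> M"
          "mv_le A x (m \<oplus> mv_mult A k a)" "mv_le A y (n \<oplus> mv_mult A l a)"
        unfolding J_def by blast
      note mn = M.mem_carrier[OF xy(3)] M.mem_carrier[OF xy(4)]
      have "mv_le A (x \<oplus> y) ((m \<oplus> mv_mult A k a) \<oplus> (n \<oplus> mv_mult A l a))"
        using xy mn a by (auto intro!: oplus_mono)
      also have "(m \<oplus> mv_mult A k a) \<oplus> (n \<oplus> mv_mult A l a) = (m \<oplus> n) \<oplus> mv_mult A (k + l) a"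
        using mn a by (simp add: mult_add oplus_ac)
      finally show "x \<oplus> y \<in> J"
        using xy M.ideal_oplus unfolding J_def by blast
    next
      fix x y assume x: "x \<in> mv_carrier A" and "y \<in> J" and le: "mv_le A x y"
      then obtain m n where y: "y \<in> mv_carrier A" "m \<in> M" "mv_le A y (m \<oplus> mv_mult A n a)"
        unfolding J_def by blast
      then have "mv_le A x (m \<oplus> mv_mult A n a)"
        using le_trans[OF x y(1) _ le] a M.mem_carrier by auto
      then show "x \<in> J"
        using x y unfolding J_def by blast
    qed
    then have "J = M"
      using M M_J by (simp add: mv_maximal_ideals_def mv_ideals_iff)
    then show False
      using a_J a by simp
  qed
  then obtain m n where m: "m \<in> M" "mv_le A (\<sim> \<zero>) (m \<oplus> mv_mult A n a)"
    unfolding J_def by blast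
  then have "m \<oplus> mv_mult A n a = \<sim> \<zero>"
    using a M.mem_carrier le_one_imp_eq by auto
  then have "mv_le A (\<sim> (mv_mult A n a)) m"
    using a m M.mem_carrier by (simp add: mv_le_def oplus_comm)
  then have "\<sim> (mv_mult A n a) \<in> M"
    using a m by (auto intro: M.ideal_down)
  then show ?thesis by (rule that)
qed

text \<open>The witness is the Lukasiewicz product of multiples of \<open>a\<close> and
  \<open>b\<close> whose negations lie in \<open>M\<close>. It is the negation of a sum in
  \<open>M\<close>, hence outside \<open>M\<close>; it is below both multiples, so an ideal
  containing \<open>a\<close> or \<open>b\<close> contains it. This plays the part of primeness of
  \<open>M\<close> and handles intersections of open sets.\<close>

lemma maximal_ideal_two_witnesses:
  assumes M: "M \<in> mv_maximal_ideals A" and a: "a \<in> mv_carrier A" "a \<notin> M"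
    and b: "b \<in> mv_carrier A" "b \<notin> M"
  obtains c where "c \<in> mv_carrier A" "c \<notin> M"
    "\<And>I. mv_ideal A I \<Longrightarrow> c \<notin> I \<Longrightarrow> a \<notin> I \<and> b \<notin> I"
proof -
  interpret M: mv_ideal A M
    using M mv_idealsD by (auto simp: mv_maximal_ideals_def)
  obtain m n where mn: "\<sim> (mv_mult A m a) \<in> M" "\<sim> (mv_mult A n b) \<in> M"
    using maximal_ideal_neg_mult[OF M] a b by metis
  let ?c = "\<sim> (\<sim> (mv_mult A m a) \<oplus> \<sim> (mv_mult A n b))"
  have le: "mv_le A ?c (mv_mult A m a)" "mv_le A ?c (mv_mult A n b)"
    using a b oplus_neg_oplus[of "mv_mult A m a" "\<sim> (mv_mult A n b)"]
      oplus_neg_oplus[of "mv_mult A n b" "\<sim> (mv_mult A m a)"]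
    by (simp_all add: mv_le_def oplus_ac)
  show ?thesis
  proof (rule that)
    show "?c \<in> mv_carrier A" using a b by auto
    show "?c \<notin> M" using M.not_neg_mem[OF M.ideal_oplus[OF mn]] .
    fix I assume "mv_ideal A I" "?c \<notin> I"
    then show "a \<notin> I \<and> b \<notin> I"
      using le a b mv_ideal.ideal_down mv_ideal.mult_mem by (metis \<open>?c \<in> mv_carrier A\<close>)
  qed
qed

lemma max_spectrum_basis:
  assumes "openin (mv_max_spectrum A) U" "M \<in> U"
  obtains c where "c \<in> mv_carrier A" "c \<notin> M"
    "{N \<in> mv_maximal_ideals A. c \<notin> N} \<subseteq> U"
proof -
  have "generate_topology_on {mv_maximal_ideals A - {M \<in> mv_maximal_ideals A. a \<in> M} | a.
       a \<in> mv_carrier A} U"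
    using assms(1) unfolding mv_max_spectrum_def by (simp add: openin_topology_generated_by_iff)
  moreover have "U \<subseteq> mv_maximal_ideals A"
    using openin_subset[OF assms(1)] by (simp add: topspace_mv_max_spectrum)
  ultimately have "\<exists>c\<in>mv_carrier A. c \<notin> M \<and> {N \<in> mv_maximal_ideals A. c \<notin> N} \<subseteq> U"
    using assms(2)
  proof (induction arbitrary: M)
    case (Int U V)
    show ?case
    proof (cases "U \<subseteq> mv_maximal_ideals A \<and> V \<subseteq> mv_maximal_ideals A")
      case True
      then obtain a b where ab: "a \<in> mv_carrier A" "a \<notin> M" "b \<in> mv_carrier A" "b \<notin> M"
          "{N \<in> mv_maximal_ideals A. a \<notin> N} \<subseteq> U" "{N \<in> mv_maximal_ideals A. b \<notin> N} \<subseteq> V"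
        using Int.IH(1)[of M] Int.IH(2)[of M] Int.prems by blast
      have M: "M \<in> mv_maximal_ideals A" using Int.prems by blast
      obtain c where c: "c \<in> mv_carrier A" "c \<notin> M"
          "\<And>I. mv_ideal A I \<Longrightarrow> c \<notin> I \<Longrightarrow> a \<notin> I \<and> b \<notin> I"
        using maximal_ideal_two_witnesses[OF M ab(1-4)] by blast
      have "{N \<in> mv_maximal_ideals A. c \<notin> N} \<subseteq> U \<inter> V"
        using ab(5,6) c(3) mv_idealsD by (auto simp: mv_maximal_ideals_def)
      then show ?thesis using c(1,2) by blast
    next
      \<comment> \<open>The premise bounds only \<open>U \<inter> V\<close>, whereas the induction
        hypotheses ask that \<open>U\<close> and \<open>V\<close> each consist of maximal ideals.
        Every generated set does, so this case is contradictory.\<close>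
      case False
      with Int.hyps show ?thesis
        using openin_subset[of "mv_max_spectrum A"]
        unfolding mv_max_spectrum_def topspace_mv_max_spectrum[unfolded mv_max_spectrum_def]
        by (auto simp: openin_topology_generated_by_iff)
    qed
  next
    case (UN K)
    then show ?case by (meson UnionE Union_upper subset_trans)
  qed auto
  then show ?thesis using that by blast
qed

section \<open>Maximal ideals of finite rank from finite images\<close>

lemma finite_hom_maximal_ideal:
  fixes B :: "'b mv"
  assumes B: "mv_algebra B" and fin: "finite (mv_carrier B)" and h: "mv_hom A B h"
    and a: "a \<in> mv_carrier A" "h a \<noteq> \<zero>\<^bsub>B\<^esub>"
  obtains M where "M \<in> mv_maximal_ideals A" "mv_finite_rank A M" "a \<notin> M"
proof -
  interpret B: mv_algebra B by (rule B)
  have hs: "\<And>x. x \<in> mv_carrier A \<Longrightarrow> h (\<sim> x) = \<sim>\<^bsub>B\<^esub> h x"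
      "\<And>x y. \<lbrakk>x \<in> mv_carrier A; y \<in> mv_carrier A\<rbrakk> \<Longrightarrow> h (x \<oplus> y) = h x \<oplus>\<^bsub>B\<^esub> h y"
      "\<And>x. x \<in> mv_carrier A \<Longrightarrow> h x \<in> mv_carrier B" "h \<zero> = \<zero>\<^bsub>B\<^esub>"
    using h by (auto simp: mv_hom_def)
  obtain n where n: "n > 0"
      "mv_mult B n (h a) \<oplus>\<^bsub>B\<^esub> mv_mult B n (h a) = mv_mult B n (h a)"
    using B.finite_ex_idempotent_mult[OF fin] a hs by metis
  define e where "e = mv_mult B n (h a)"
  define f where "f = \<sim>\<^bsub>B\<^esub> e"
  have e: "e \<in> mv_carrier B" "e \<oplus>\<^bsub>B\<^esub> e = e" "e \<noteq> \<zero>\<^bsub>B\<^esub>"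
    using n a(2) hs(3)[OF a(1)] B.mult_eq_zeroD[OF hs(3)[OF a(1)]] by (auto simp: e_def)
  have f: "f \<in> mv_carrier B" "f \<oplus>\<^bsub>B\<^esub> f = f"
    using e(1) B.neg_idempotent[OF e(1,2)] by (simp_all add: f_def)
  have f_not_one: "f \<noteq> \<sim>\<^bsub>B\<^esub> \<zero>\<^bsub>B\<^esub>"
    using e(1,3) unfolding f_def by (metis B.neg_neg B.zero_closed)
  \<comment> \<open>The preimage of the elements below the idempotent \<open>f\<close>. Stating
    "below" as absorption by \<open>f\<close> makes closure under sums a matter of
    associativity.\<close>
  define J where "J = {x \<in> mv_carrier A. h x \<oplus>\<^bsub>B\<^esub> f = f}"
  have ker_J: "mv_kernel A B h \<subseteq> J"
    using f by (auto simp: J_def mv_kernel_def)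
  \<comment> \<open>The image of this element is \<open>f\<close>, which absorbs itself by
    idempotence. Its membership will keep \<open>a\<close> out of \<open>M\<close>, since no proper
    ideal contains both a multiple of \<open>a\<close> and the negation of that multiple.\<close>
  have "\<sim> (mv_mult A n a) \<in> J"
    using a f hom_mult[OF h a(1), of n] by (auto simp: J_def hs e_def f_def)
  have "mv_ideal A J"
  proof
    fix x y assume x: "x \<in> mv_carrier A" and y: "y \<in> J" and "mv_le A x y"
    then obtain t where t: "t \<in> mv_carrier A" "y = x \<oplus> t"
      by (auto simp: J_def le_iff_ex)
    have "f = (h x \<oplus>\<^bsub>B\<^esub> f) \<oplus>\<^bsub>B\<^esub> h t"
      using x y t f by (simp add: J_def hs B.oplus_ac)
    then have "mv_le B (h x \<oplus>\<^bsub>B\<^esub> f) f"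
      using x t f hs by (metis B.le_oplus1 B.oplus_closed)
    moreover have "mv_le B f (h x \<oplus>\<^bsub>B\<^esub> f)"
      using x f hs by (auto intro: B.le_oplus2)
    ultimately show "x \<in> J"
      using x f hs by (auto simp: J_def intro: B.le_antisym)
  qed (use f f_not_one in \<open>auto simp: J_def hs B.oplus_assoc\<close>)
  \<comment> \<open>Ideals above the kernel are determined by their images in the finite
    \<open>B\<close>, so \<open>S\<close> is finite and a maximal member above \<open>J\<close>
    exists without Zorn's lemma.\<close>
  define S where "S = {K \<in> mv_ideals A. mv_kernel A B h \<subseteq> K}"
  \<comment> \<open>Elements with equal images are congruent modulo the kernel, hence modulo
    \<open>K\<close>; as \<open>y\<close> is congruent to \<open>\<zero>\<close>, so is
    \<open>x\<close>.\<close>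
  have saturated: "x \<in> K" if K: "K \<in> S" and x: "x \<in> mv_carrier A" and y: "y \<in> K" "h x = h y" for K x y
  proof -
    interpret K: mv_ideal A K using K mv_idealsD by (auto simp: S_def)
    have "(x, y) \<in> mv_cong A (mv_kernel A B h)"
      using mv_cong_kernel[OF B h] x y K.mem_carrier by auto
    then have "(x, y) \<in> mv_cong A K"
      using K by (auto simp: mv_cong_def S_def)
    then have "(x, \<zero>) \<in> mv_cong A K"
      using y(1) K.cong_equiv by (meson K.cong_zero_iff equivE transE)
    then show ?thesis by (simp add: K.cong_zero_iff)
  qed
  have S_sub: "K \<subseteq> mv_carrier A" if "K \<in> S" for K
    using that mv_ideal.ideal_subset[OF mv_idealsD] by (auto simp: S_def)
  have "inj_on (image h) S"
  proof (rule inj_onI)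
    have sub: "K \<subseteq> L" if KL: "K \<in> S" "L \<in> S" "h ` K = h ` L" for K L
    proof
      fix x assume x: "x \<in> K"
      then have "h x \<in> h ` L" using KL(3) by blast
      then obtain y where "y \<in> L" "h x = h y" by blast
      then show "x \<in> L" using saturated[OF KL(2)] S_sub[OF KL(1)] x by blast
    qed
    show "K = L" if "K \<in> S" "L \<in> S" "h ` K = h ` L" for K L
      using sub[OF that] sub[OF that(2,1) that(3)[symmetric]] by (rule subset_antisym)
  qed
  moreover have "image h ` S \<subseteq> Pow (mv_carrier B)"
    using S_sub hs by blast
  ultimately have "finite S"
    using fin by (meson finite_Pow_iff finite_imageD finite_subset)
  moreover have "J \<in> S"
    using ker_J \<open>mv_ideal A J\<close> by (simp add: S_def mv_ideals_iff)
  ultimately obtain M where M: "M \<in> S" "J \<subseteq> M" "\<And>K. K \<in> S \<Longrightarrow> M \<subseteq> K \<Longrightarrow> M = K"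
    using finite_has_maximal2[of S J] by blast
  interpret M: mv_ideal A M
    using M mv_idealsD by (auto simp: S_def)
  \<comment> \<open>An ideal containing \<open>M\<close> also contains the kernel, so it belongs to
    \<open>S\<close>; maximality within \<open>S\<close> is therefore maximality among all
    ideals.\<close>
  have "M \<in> mv_maximal_ideals A"
    using M unfolding mv_maximal_ideals_def S_def by auto
  moreover have "mv_finite_rank A M"
  proof -
    let ?c = "\<lambda>x. mv_cong A M `` {x}"
    have class_eq: "?c x = ?c y" if "x \<in> mv_carrier A" "y \<in> mv_carrier A" "h x = h y" for x y
    proof -
      have "(x, y) \<in> mv_cong A (mv_kernel A B h)"
        using mv_cong_kernel[OF B h] that by auto
      then have "(x, y) \<in> mv_cong A M"
        using M by (auto simp: mv_cong_def S_def)
      then show ?thesis by (rule equiv_class_eq[OF M.cong_equiv])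
    qed
    \<comment> \<open>The class of \<open>x\<close> depends only on \<open>h x\<close>, so the
      quotient map factors through the finite image of \<open>h\<close>; any choice of preimages
      realises the factorisation.\<close>
    have "?c x = ?c (inv_into (mv_carrier A) h (h x))" if "x \<in> mv_carrier A" for x
      by (rule class_eq) (use that in \<open>auto simp: inv_into_into f_inv_into_f\<close>)
    then have "?c ` mv_carrier A = (\<lambda>b. ?c (inv_into (mv_carrier A) h b)) ` h ` mv_carrier A"
      unfolding image_image by (rule image_cong[OF refl])
    moreover have "finite (h ` mv_carrier A)"
      using hs(3) by (intro finite_subset[OF _ fin]) blast
    moreover have "mv_carrier (mv_quotient A M) = ?c ` mv_carrier A"
      by (auto simp: mv_quotient_def quotient_def)
    ultimately show ?thesis
      by (simp add: mv_finite_rank_def)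
  qed
  moreover have "a \<notin> M"
    using M.mult_mem[of a n] M.not_neg_mem \<open>\<sim> (mv_mult A n a) \<in> J\<close> M(2) by blast
  ultimately show ?thesis by (rule that)
qed

section \<open>The two implications\<close>

lemma residually_finite_maximal_ideal:
  assumes "mv_residually_finite A" "a \<in> mv_carrier A" "a \<noteq> \<zero>"
  obtains M where "M \<in> mv_maximal_ideals A" "mv_finite_rank A M" "a \<notin> M"
proof -
  obtain B :: "nat mv" and h where
      B: "mv_algebra B" "finite (mv_carrier B)" "mv_hom A B h" "h a \<noteq> h \<zero>"
    using assms unfolding mv_residually_finite_def by blast
  moreover have "h \<zero> = \<zero>\<^bsub>B\<^esub>"
    using B by (simp add: mv_hom_def)
  ultimately show ?thesis
    using finite_hom_maximal_ideal[OF B(1-3) assms(2)] that by auto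
qed

lemma maximal_ideal_zero_mem: "M \<in> mv_maximal_ideals A \<Longrightarrow> \<zero> \<in> M"
  using mv_ideal.ideal_zero[OF mv_idealsD] by (auto simp: mv_maximal_ideals_def)

lemma residually_finite_imp_semisimple:
  assumes "mv_residually_finite A"
  shows "mv_semisimple A"
proof -
  have "a = \<zero>" if a: "a \<in> mv_carrier A" "a \<in> \<Inter>(mv_maximal_ideals A)" for a
  proof (rule ccontr)
    assume "a \<noteq> \<zero>"
    then obtain M where "M \<in> mv_maximal_ideals A" "a \<notin> M"
      by (rule residually_finite_maximal_ideal[OF assms a(1)])
    then show False using a(2) by blast
  qed
  moreover have "\<zero> \<in> \<Inter>(mv_maximal_ideals A)"
    using maximal_ideal_zero_mem by blast
  ultimately show ?thesis
    unfolding mv_semisimple_def using zero_closed by blast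
qed

text \<open>A neighbourhood of \<open>M\<close> contains a basic one given by some \<open>c\<close>
  outside \<open>M\<close>. Such a \<open>c\<close> is nonzero, so a maximal ideal of finite rank
  omits it and lies in the neighbourhood.\<close>

lemma residually_finite_imp_dense:
  assumes "mv_residually_finite A"
  shows "mv_max_spectrum A closure_of {M \<in> mv_maximal_ideals A. mv_finite_rank A M}
    = topspace (mv_max_spectrum A)"
proof -
  have "\<exists>N\<in>{M \<in> mv_maximal_ideals A. mv_finite_rank A M}. N \<in> U"
    if M: "M \<in> mv_maximal_ideals A" and U: "M \<in> U" "openin (mv_max_spectrum A) U" for M U
  proof -
    obtain c where c: "c \<in> mv_carrier A" "c \<notin> M" "{N \<in> mv_maximal_ideals A. c \<notin> N} \<subseteq> U"
      using max_spectrum_basis[OF U(2,1)] .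
    have "c \<noteq> \<zero>"
      using c(2) maximal_ideal_zero_mem[OF M] by auto
    then obtain N where "N \<in> mv_maximal_ideals A" "mv_finite_rank A N" "c \<notin> N"
      by (rule residually_finite_maximal_ideal[OF assms c(1)])
    then show ?thesis
      using c(3) by blast
  qed
  then show ?thesis
    by (auto simp: closure_of_def topspace_mv_max_spectrum)
qed

lemma semisimple_dense_imp_residually_finite:
  assumes ss: "mv_semisimple A"
    and dense: "mv_max_spectrum A closure_of {M \<in> mv_maximal_ideals A. mv_finite_rank A M}
      = topspace (mv_max_spectrum A)"
  shows "mv_residually_finite A"
  unfolding mv_residually_finite_def
proof (intro ballI impI)
  fix x y assume x: "x \<in> mv_carrier A" and y: "y \<in> mv_carrier A" and "x \<noteq> y"
  define d where "d = \<sim> (\<sim> x \<oplus> y) \<oplus> \<sim> (\<sim> y \<oplus> x)"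
  have d: "d \<in> mv_carrier A" "d \<noteq> \<zero>"
    using x y \<open>x \<noteq> y\<close> by (auto simp: d_def dist_eq_zero_iff)
  then obtain M where M: "M \<in> mv_maximal_ideals A" "d \<notin> M"
    using ss unfolding mv_semisimple_def by blast
  \<comment> \<open>Written as a set difference to match the generating family of the topology
    literally.\<close>
  let ?U = "mv_maximal_ideals A - {M \<in> mv_maximal_ideals A. d \<in> M}"
  have open_U: "openin (mv_max_spectrum A) ?U"
    unfolding mv_max_spectrum_def using d(1) by (intro topology_generated_by_Basis) blast
  have "M \<in> mv_max_spectrum A closure_of {M \<in> mv_maximal_ideals A. mv_finite_rank A M}"
    using M dense by (simp add: topspace_mv_max_spectrum)
  then have "\<forall>T. M \<in> T \<and> openin (mv_max_spectrum A) T \<longrightarrow>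
      (\<exists>N. N \<in> {M \<in> mv_maximal_ideals A. mv_finite_rank A M} \<and> N \<in> T)"
    unfolding in_closure_of by (rule conjunct2)
  from this[THEN spec, of ?U]
  have "\<exists>N. N \<in> {M \<in> mv_maximal_ideals A. mv_finite_rank A M} \<and> N \<in> ?U"
    using M open_U by simp
  then obtain N where N: "N \<in> mv_maximal_ideals A" "mv_finite_rank A N" "d \<notin> N"
    by blast
  then have N_ideal: "N \<in> mv_ideals A"
    by (simp add: mv_maximal_ideals_def)
  note Q = mv_quotient_ideal[OF N_ideal]
  have "mv_cong A N `` {x} \<noteq> mv_cong A N `` {y}"
    using mv_cong_kernel[OF Q(1,2)] N(3) x y unfolding Q(3) by (auto simp: mv_cong_def d_def)
  \<comment> \<open>The finite quotient lives over \<open>'a set\<close>;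
    \<open>mv_finite_separation\<close> copies it to \<open>nat\<close> and preserves which elements
    are separated.\<close>
  then show "\<exists>(B :: nat mv) h. mv_algebra B \<and> finite (mv_carrier B) \<and> mv_hom A B h \<and> h x \<noteq> h y"
    using mv_finite_separation[OF Q(1) N(2)[unfolded mv_finite_rank_def] Q(2)] x y by metis
qed

end

theorem theorem2p1:
  fixes A :: "'a mv"
  assumes "mv_algebra A"
    and "mv_finitely_generated A"
  shows "mv_residually_finite A \<longleftrightarrow>
    mv_semisimple A \<and>
    mv_max_spectrum A closure_of {M \<in> mv_maximal_ideals A. mv_finite_rank A M}
      = topspace (mv_max_spectrum A)"
  using mv_algebra.residually_finite_imp_semisimple[OF assms(1)]
    mv_algebra.residually_finite_imp_dense[OF assms(1)]
    mv_algebra.semisimple_dense_imp_residually_finite[OF assms(1)] by blast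

end
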